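(* Let $(C,\Delta,P)$ be a noncounitary Rota-Baxter coalgebra of weight $\lambda\in\mathbb{K}$. Define $\Delta_P=(P\otimes\mathrm{id})\Delta+(\mathrm{id}\otimes P)\Delta+\lambda\Delta$. Then $\Delta_P P=(P\otimes P)\Delta$ and $(C,\Delta_P,P)$ is again a noncounitary Rota-Baxter coalgebra of weight $\lambda$.
   Context: $\mathbb{K}$ is a fixed ground field of characteristic 0; all vector spaces, coalgebras and tensor products are over $\mathbb{K}$. A noncounitary coalgebra $(C,\Delta)$ is a vector space with a coassociative linear map $\Delta:C\to C\otimes C$, no counit being required. A noncounitary Rota-Baxter coalgebra $(C,\Delta,P)$ of weight $\lambda\in\mathbb{K}$ is a noncounitary coalgebra $(C,\Delta)$ with a linear endomorphism $P$ of $C$ such that $(P\otimes P)\Delta=(\mathrm{id}\otimes P)\Delta P+(P\otimes\mathrm{id})\Delta P+\lambda\Delta P$. *)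

theory Defs
  imports "Jordan_Normal_Form.Missing_VectorSpace" "HOL-Algebra.AbelCoset"
begin

text \<open>Vector spaces are the records of \<^locale>\<open>vectorspace\<close>, i.e. modules with explicit carrier
  over a field with explicit carrier. The ring components \<^const>\<open>mult\<close> and \<^const>\<open>one\<close> of a module
  record carry no meaning and are filled with zero, as in \<^const>\<open>direct_sum\<close>. Equations between
  linear maps are stated pointwise on the carrier of the domain.\<close>


subsection \<open>Tensor products\<close>

text \<open>The free vector space on \<open>S\<close>: finitely supported functions from \<open>S\<close> to \<open>K\<close>, extended by
  zero outside \<open>S\<close>.\<close>

definition free_space :: "('k, 'm) ring_scheme \<Rightarrow> 's set \<Rightarrow> ('k, 's \<Rightarrow> 'k) module" where
  "free_space K S =
    \<lparr>carrier = {u. (\<forall>s\<in>S. u s \<in> carrier K) \<and> (\<forall>s. s \<notin> S \<longrightarrow> u s = \<zero>\<^bsub>K\<^esub>) \<and>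
                   finite {s. u s \<noteq> \<zero>\<^bsub>K\<^esub>}},
     mult = (\<lambda>u v s. \<zero>\<^bsub>K\<^esub>), one = (\<lambda>s. \<zero>\<^bsub>K\<^esub>), zero = (\<lambda>s. \<zero>\<^bsub>K\<^esub>),
     add = (\<lambda>u v s. u s \<oplus>\<^bsub>K\<^esub> v s), smult = (\<lambda>c u s. c \<otimes>\<^bsub>K\<^esub> u s)\<rparr>"

definition free_gen :: "('k, 'm) ring_scheme \<Rightarrow> 's \<Rightarrow> 's \<Rightarrow> 'k" where
  "free_gen K s = (\<lambda>t. if t = s then \<one>\<^bsub>K\<^esub> else \<zero>\<^bsub>K\<^esub>)"

definition quotient_space :: "('k, 'v, 'n) module_scheme \<Rightarrow> 'v set \<Rightarrow> ('k, 'v set) module" where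
  "quotient_space V W =
    \<lparr>carrier = a_rcosets\<^bsub>V\<^esub> W, mult = (\<lambda>X Y. W), one = W, zero = W,
     add = (\<lambda>X Y. X <+>\<^bsub>V\<^esub> Y), smult = (\<lambda>c X. \<Union>x\<in>X. W +>\<^bsub>V\<^esub> (c \<odot>\<^bsub>V\<^esub> x))\<rparr>"

definition bilinear_relations ::
    "('k, 'm) ring_scheme \<Rightarrow> ('k, 'a, 'n) module_scheme \<Rightarrow> ('k, 'b, 'p) module_scheme
      \<Rightarrow> ('a \<times> 'b \<Rightarrow> 'k) set" where
  "bilinear_relations K V W =
    (let F = free_space K (carrier V \<times> carrier W); g = (\<lambda>v w. free_gen K (v, w)) in
      {g (v \<oplus>\<^bsub>V\<^esub> v') w \<ominus>\<^bsub>F\<^esub> (g v w \<oplus>\<^bsub>F\<^esub> g v' w) | v v' w.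
          v \<in> carrier V \<and> v' \<in> carrier V \<and> w \<in> carrier W} \<union>
      {g v (w \<oplus>\<^bsub>W\<^esub> w') \<ominus>\<^bsub>F\<^esub> (g v w \<oplus>\<^bsub>F\<^esub> g v w') | v w w'.
          v \<in> carrier V \<and> w \<in> carrier W \<and> w' \<in> carrier W} \<union>
      {g (c \<odot>\<^bsub>V\<^esub> v) w \<ominus>\<^bsub>F\<^esub> c \<odot>\<^bsub>F\<^esub> g v w | c v w.
          c \<in> carrier K \<and> v \<in> carrier V \<and> w \<in> carrier W} \<union>
      {g v (c \<odot>\<^bsub>W\<^esub> w) \<ominus>\<^bsub>F\<^esub> c \<odot>\<^bsub>F\<^esub> g v w | c v w.
          c \<in> carrier K \<and> v \<in> carrier V \<and> w \<in> carrier W})"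

definition tensor_relations ::
    "('k, 'm) ring_scheme \<Rightarrow> ('k, 'a, 'n) module_scheme \<Rightarrow> ('k, 'b, 'p) module_scheme
      \<Rightarrow> ('a \<times> 'b \<Rightarrow> 'k) set" where
  "tensor_relations K V W =
    module.span K (free_space K (carrier V \<times> carrier W)) (bilinear_relations K V W)"

definition tensor ::
    "('k, 'm) ring_scheme \<Rightarrow> ('k, 'a, 'n) module_scheme \<Rightarrow> ('k, 'b, 'p) module_scheme
      \<Rightarrow> ('k, ('a \<times> 'b \<Rightarrow> 'k) set) module" where
  "tensor K V W =
    quotient_space (free_space K (carrier V \<times> carrier W)) (tensor_relations K V W)"

definition tensor_elem ::
    "('k, 'm) ring_scheme \<Rightarrow> ('k, 'a, 'n) module_scheme \<Rightarrow> ('k, 'b, 'p) module_scheme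
      \<Rightarrow> 'a \<Rightarrow> 'b \<Rightarrow> ('a \<times> 'b \<Rightarrow> 'k) set" where
  "tensor_elem K V W v w =
    tensor_relations K V W +>\<^bsub>free_space K (carrier V \<times> carrier W)\<^esub> free_gen K (v, w)"


subsection \<open>Linear maps out of tensor products\<close>

text \<open>For a bilinear \<open>b\<close> the formal sum map below is constant on each class \<open>X\<close> in the tensor
  product, so that \<^const>\<open>the_elem\<close> extracts the value of the induced linear map at \<open>X\<close>.\<close>

definition formal_sum_map ::
    "('k, 'm) ring_scheme \<Rightarrow> ('k, 'u, 'n) module_scheme \<Rightarrow> ('s \<Rightarrow> 'u) \<Rightarrow> ('s \<Rightarrow> 'k) \<Rightarrow> 'u" where
  "formal_sum_map K U h u = (\<Oplus>\<^bsub>U\<^esub> s \<in> {s. u s \<noteq> \<zero>\<^bsub>K\<^esub>}. u s \<odot>\<^bsub>U\<^esub> h s)"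

definition tensor_lift ::
    "('k, 'm) ring_scheme \<Rightarrow> ('k, 'u, 'n) module_scheme \<Rightarrow> ('a \<Rightarrow> 'b \<Rightarrow> 'u)
      \<Rightarrow> ('a \<times> 'b \<Rightarrow> 'k) set \<Rightarrow> 'u" where
  "tensor_lift K U b X = the_elem (formal_sum_map K U (\<lambda>(v, w). b v w) ` X)"

text \<open>\<open>tensor_map K V' W' f g\<close> is the map \<open>f \<otimes> g\<close> with values in \<open>V' \<otimes> W'\<close>.\<close>

definition tensor_map ::
    "('k, 'm) ring_scheme \<Rightarrow> ('k, 'c, 'n) module_scheme \<Rightarrow> ('k, 'd, 'p) module_scheme
      \<Rightarrow> ('a \<Rightarrow> 'c) \<Rightarrow> ('b \<Rightarrow> 'd) \<Rightarrow> ('a \<times> 'b \<Rightarrow> 'k) set \<Rightarrow> ('c \<times> 'd \<Rightarrow> 'k) set" where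
  "tensor_map K V' W' f g =
    tensor_lift K (tensor K V' W') (\<lambda>v w. tensor_elem K V' W' (f v) (g w))"

text \<open>The canonical isomorphism from \<open>(U \<otimes> V) \<otimes> W\<close> to \<open>U \<otimes> (V \<otimes> W)\<close>.\<close>

definition tensor_assoc ::
    "('k, 'm) ring_scheme \<Rightarrow> ('k, 'a, 'n) module_scheme \<Rightarrow> ('k, 'b, 'p) module_scheme
      \<Rightarrow> ('k, 'c, 'q) module_scheme
      \<Rightarrow> (('a \<times> 'b \<Rightarrow> 'k) set \<times> 'c \<Rightarrow> 'k) set \<Rightarrow> ('a \<times> ('b \<times> 'c \<Rightarrow> 'k) set \<Rightarrow> 'k) set" where
  "tensor_assoc K U V W =
    (let T = tensor K U (tensor K V W) in
      tensor_lift K T (\<lambda>x w. tensor_lift K T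
        (\<lambda>u v. tensor_elem K U (tensor K V W) u (tensor_elem K V W v w)) x))"


subsection \<open>Rota--Baxter coalgebras\<close>

locale noncounitary_coalgebra = vectorspace K C for K (structure) and C (structure) +
  fixes \<Delta>
  assumes comult_linear: "\<Delta> \<in> module_hom K C (tensor K C C)"
    and coassoc: "x \<in> carrier C \<Longrightarrow>
      tensor_assoc K C C C (tensor_map K (tensor K C C) C \<Delta> id (\<Delta> x)) =
      tensor_map K C (tensor K C C) id \<Delta> (\<Delta> x)"

locale noncounitary_rota_baxter_coalgebra = noncounitary_coalgebra K C \<Delta>
  for K (structure) and C (structure) and \<Delta> +
  fixes P and lam
  assumes weight_closed: "lam \<in> carrier K"
    and operator_linear: "P \<in> module_hom K C C"
    and rota_baxter: "x \<in> carrier C \<Longrightarrow>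
      tensor_map K C C P P (\<Delta> x) =
        tensor_map K C C id P (\<Delta> (P x)) \<oplus>\<^bsub>tensor K C C\<^esub>
        tensor_map K C C P id (\<Delta> (P x)) \<oplus>\<^bsub>tensor K C C\<^esub>
        lam \<odot>\<^bsub>tensor K C C\<^esub> \<Delta> (P x)"

text \<open>\<open>\<Delta>\<^sub>P = (P \<otimes> id) \<Delta> + (id \<otimes> P) \<Delta> + \<lambda> \<Delta>\<close>\<close>

definition derived_comult ::
    "('k, 'm) ring_scheme \<Rightarrow> ('k, 'c, 'n) module_scheme \<Rightarrow> ('c \<Rightarrow> ('c \<times> 'c \<Rightarrow> 'k) set)
      \<Rightarrow> ('c \<Rightarrow> 'c) \<Rightarrow> 'k \<Rightarrow> 'c \<Rightarrow> ('c \<times> 'c \<Rightarrow> 'k) set" where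
  "derived_comult K C \<Delta> P lam x =
    tensor_map K C C P id (\<Delta> x) \<oplus>\<^bsub>tensor K C C\<^esub>
    tensor_map K C C id P (\<Delta> x) \<oplus>\<^bsub>tensor K C C\<^esub>
    lam \<odot>\<^bsub>tensor K C C\<^esub> \<Delta> x"

end

theory Submission
  imports Defs
begin

text \<open>Put \<open>\<Phi> = P \<otimes> id + id \<otimes> P + \<lambda>\<close>, so that \<open>\<Delta>\<^sub>P = \<Phi> \<Delta>\<close>. The Rota--Baxter equation says
  \<open>\<Delta>\<^sub>P P = (P \<otimes> P) \<Delta>\<close>, and the equation for \<open>\<Delta>\<^sub>P\<close> follows because \<open>P \<otimes> P\<close> commutes with
  \<open>P \<otimes> id\<close> and \<open>id \<otimes> P\<close>. Using \<open>\<Delta>\<^sub>P P = (P \<otimes> P) \<Delta>\<close> once more,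
  \<open>(\<Delta>\<^sub>P \<otimes> id) \<Delta>\<^sub>P = E (\<Delta> \<otimes> id) \<Delta>\<close> with
  \<open>E = PP1 + P1P + 1PP + \<lambda> (P11 + 1P1 + 11P) + \<lambda>\<^sup>2\<close>, which is symmetric in the three tensor
  factors; expanding \<open>(id \<otimes> \<Delta>\<^sub>P) \<Delta>\<^sub>P\<close> gives the same \<open>E\<close>, so coassociativity is inherited.\<close>


section \<open>Linear maps\<close>

lemma module_homI:
  assumes "\<And>x. x \<in> carrier M \<Longrightarrow> f x \<in> carrier N"
    and "\<And>x y. x \<in> carrier M \<Longrightarrow> y \<in> carrier M \<Longrightarrow> f (x \<oplus>\<^bsub>M\<^esub> y) = f x \<oplus>\<^bsub>N\<^esub> f y"
    and "\<And>c x. c \<in> carrier K \<Longrightarrow> x \<in> carrier M \<Longrightarrow> f (c \<odot>\<^bsub>M\<^esub> x) = c \<odot>\<^bsub>N\<^esub> f x"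
  shows "f \<in> module_hom K M N"
  using assms by (auto simp: module_hom_def)

lemma module_hom_in:
  "f \<in> module_hom K M N \<Longrightarrow> x \<in> carrier M \<Longrightarrow> f x \<in> carrier N"
  by (auto simp: module_hom_def)

lemma module_hom_id: "id \<in> module_hom K M M"
  by (auto simp: module_hom_def)

lemma module_hom_ident: "(\<lambda>x. x) \<in> module_hom K M M"
  by (auto simp: module_hom_def)

lemma module_hom_comp:
  "f \<in> module_hom K L M \<Longrightarrow> g \<in> module_hom K M N \<Longrightarrow> (\<lambda>x. g (f x)) \<in> module_hom K L N"
  by (auto simp: module_hom_def Pi_def)

text \<open>The carrier of \<open>M\<close> is closed under sums and multiples, so linearity only
  sees values on the carrier. This transfers it from a composite to a function known to agree with
  that composite on the carrier, as in \<open>tensor_map_comp\<close>.\<close>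

lemma module_hom_cong:
  assumes "module K M" "f \<in> module_hom K M N" "\<And>x. x \<in> carrier M \<Longrightarrow> f x = g x"
  shows "g \<in> module_hom K M N"
proof -
  interpret M: module K M by fact
  show ?thesis
    using assms(2)
    by (intro module_homI)
       (simp_all add: assms(3)[symmetric] module_hom_in module_hom_add module_hom_smult)
qed

lemma module_hom_plus:
  assumes "module K N" "f \<in> module_hom K M N" "g \<in> module_hom K M N"
  shows "(\<lambda>x. f x \<oplus>\<^bsub>N\<^esub> g x) \<in> module_hom K M N"
proof -
  interpret N: module K N by fact
  show ?thesis
    using assms(2,3)
    by (intro module_homI)
       (simp_all add: module_hom_in module_hom_add module_hom_smult N.smult_r_distr N.M.a_ac)
qed

lemma module_hom_scale:
  assumes "module K N" "f \<in> module_hom K M N" "c \<in> carrier K"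
  shows "(\<lambda>x. c \<odot>\<^bsub>N\<^esub> f x) \<in> module_hom K M N"
proof -
  interpret N: module K N by fact
  show ?thesis
    using assms(2,3)
    by (intro module_homI)
       (simp_all add: module_hom_in module_hom_add module_hom_smult N.smult_r_distr
          N.smult_assoc1[symmetric] N.R.m_comm)
qed

lemma module_hom_minus:
  assumes "module K M" "module K N" "f \<in> module_hom K M N" "x \<in> carrier M" "y \<in> carrier M"
  shows "f (x \<ominus>\<^bsub>M\<^esub> y) = f x \<ominus>\<^bsub>N\<^esub> f y"
proof -
  interpret M: module K M by fact
  interpret N: module K N by fact
  \<comment> \<open>The difference is written as a sum with the multiple of \<open>y\<close> by
    minus one, so that additivity and homogeneity suffice.\<close>
  have "f (x \<oplus>\<^bsub>M\<^esub> (\<ominus>\<^bsub>K\<^esub> \<one>\<^bsub>K\<^esub>) \<odot>\<^bsub>M\<^esub> y) = f x \<oplus>\<^bsub>N\<^esub> (\<ominus>\<^bsub>K\<^esub> \<one>\<^bsub>K\<^esub>) \<odot>\<^bsub>N\<^esub> f y"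
    using assms by (simp add: module_hom_add module_hom_smult)
  then show ?thesis
    using assms by (simp add: M.smult_minus_1 N.smult_minus_1 module_hom_in a_minus_def)
qed

lemma module_hom_zero:
  assumes "module K M" "module K N" "f \<in> module_hom K M N"
  shows "f \<zero>\<^bsub>M\<^esub> = \<zero>\<^bsub>N\<^esub>"
proof -
  interpret M: module K M by fact
  interpret N: module K N by fact
  have "f (\<zero>\<^bsub>K\<^esub> \<odot>\<^bsub>M\<^esub> \<zero>\<^bsub>M\<^esub>) = \<zero>\<^bsub>K\<^esub> \<odot>\<^bsub>N\<^esub> f \<zero>\<^bsub>M\<^esub>"
    using assms(3) by (simp only: module_hom_smult M.R.zero_closed M.M.zero_closed)
  then show ?thesis using assms(3) by (simp add: module_hom_in)
qed


section \<open>Free modules\<close>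

lemma free_space_simps:
  "carrier (free_space K S) = {u. (\<forall>s\<in>S. u s \<in> carrier K) \<and> (\<forall>s. s \<notin> S \<longrightarrow> u s = \<zero>\<^bsub>K\<^esub>) \<and>
                   finite {s. u s \<noteq> \<zero>\<^bsub>K\<^esub>}}"
  "zero (free_space K S) = (\<lambda>s. \<zero>\<^bsub>K\<^esub>)"
  "u \<oplus>\<^bsub>free_space K S\<^esub> v = (\<lambda>s. u s \<oplus>\<^bsub>K\<^esub> v s)"
  "c \<odot>\<^bsub>free_space K S\<^esub> u = (\<lambda>s. c \<otimes>\<^bsub>K\<^esub> u s)"
  by (simp_all add: free_space_def)

context cring
begin

text \<open>Values outside \<open>S\<close> are zero and hence scalars too, so the claim covers
  every \<open>s\<close>.\<close>

lemma free_space_coeff: "u \<in> carrier (free_space R S) \<Longrightarrow> u s \<in> carrier R"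
  by (cases "s \<in> S") (auto simp: free_space_simps)

lemma free_space_add_closed:
  assumes "u \<in> carrier (free_space R S)" "v \<in> carrier (free_space R S)"
  shows "u \<oplus>\<^bsub>free_space R S\<^esub> v \<in> carrier (free_space R S)"
proof -
  have "{s. u s \<oplus> v s \<noteq> \<zero>} \<subseteq> {s. u s \<noteq> \<zero>} \<union> {s. v s \<noteq> \<zero>}" by auto
  moreover have "finite ({s. u s \<noteq> \<zero>} \<union> {s. v s \<noteq> \<zero>})"
    using assms by (simp add: free_space_simps)
  ultimately have "finite {s. u s \<oplus> v s \<noteq> \<zero>}" by (rule finite_subset)
  then show ?thesis using assms by (auto simp: free_space_simps)
qed

lemma free_space_smult_closed:
  assumes "c \<in> carrier R" "u \<in> carrier (free_space R S)"
  shows "c \<odot>\<^bsub>free_space R S\<^esub> u \<in> carrier (free_space R S)"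
proof -
  have "{s. c \<otimes> u s \<noteq> \<zero>} \<subseteq> {s. u s \<noteq> \<zero>}" using assms(1) by auto
  then have "finite {s. c \<otimes> u s \<noteq> \<zero>}"
    using assms(2) by (simp add: free_space_simps finite_subset)
  then show ?thesis using assms by (auto simp: free_space_simps)
qed

lemma free_gen_closed: "s \<in> S \<Longrightarrow> free_gen R s \<in> carrier (free_space R S)"
  by (auto simp: free_space_simps free_gen_def)

lemma free_space_abelian_group: "abelian_group (free_space R S)"
proof (rule abelian_groupI)
  show "\<zero>\<^bsub>free_space R S\<^esub> \<in> carrier (free_space R S)"
    by (simp add: free_space_simps)
next
  fix u v assume "u \<in> carrier (free_space R S)" "v \<in> carrier (free_space R S)"
  then show "u \<oplus>\<^bsub>free_space R S\<^esub> v \<in> carrier (free_space R S)"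
    by (rule free_space_add_closed)
next
  fix u assume "u \<in> carrier (free_space R S)"
  note c = free_space_coeff[OF this]
  show "\<zero>\<^bsub>free_space R S\<^esub> \<oplus>\<^bsub>free_space R S\<^esub> u = u"
    by (simp add: free_space_simps(2-) c)
next
  fix u v assume "u \<in> carrier (free_space R S)" "v \<in> carrier (free_space R S)"
  note c = this[THEN free_space_coeff]
  show "u \<oplus>\<^bsub>free_space R S\<^esub> v = v \<oplus>\<^bsub>free_space R S\<^esub> u"
    by (simp add: free_space_simps(3) a_comm[OF c])
next
  fix u v w
  assume "u \<in> carrier (free_space R S)" "v \<in> carrier (free_space R S)"
    "w \<in> carrier (free_space R S)"
  note c = this[THEN free_space_coeff]
  show "u \<oplus>\<^bsub>free_space R S\<^esub> v \<oplus>\<^bsub>free_space R S\<^esub> w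
      = u \<oplus>\<^bsub>free_space R S\<^esub> (v \<oplus>\<^bsub>free_space R S\<^esub> w)"
    by (simp add: free_space_simps(3) a_assoc[OF c])
next
  fix u assume u: "u \<in> carrier (free_space R S)"
  \<comment> \<open>The multiple by minus one serves as additive inverse; its finite support comes
    from \<open>free_space_smult_closed\<close>.\<close>
  have "(\<ominus> \<one>) \<odot>\<^bsub>free_space R S\<^esub> u \<oplus>\<^bsub>free_space R S\<^esub> u = \<zero>\<^bsub>free_space R S\<^esub>"
    by (simp add: free_space_simps(2-) free_space_coeff[OF u] l_minus l_neg)
  then show "\<exists>v\<in>carrier (free_space R S). v \<oplus>\<^bsub>free_space R S\<^esub> u = \<zero>\<^bsub>free_space R S\<^esub>"
    using free_space_smult_closed[OF _ u] by blast
qed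

lemma free_space_module: "module R (free_space R S)"
proof (rule moduleI)
  show "abelian_group (free_space R S)" by (rule free_space_abelian_group)
\<comment> \<open>Closure goals are settled first. The remaining ones unfold the operations but not
  the carrier, so that \<open>free_space_coeff\<close> still matches the assumptions.\<close>
qed (simp_all add: free_space_smult_closed is_cring,
     simp_all add: free_space_simps(2-) free_space_coeff l_distr r_distr m_assoc)

text \<open>A finitely supported function is a finite linear combination of generators. The rule is
  used to show that linear maps agreeing on generators agree everywhere.\<close>

lemma free_space_induct [consumes 1, case_names zero gen add smult]:
  assumes u: "u \<in> carrier (free_space R S)"
    and zero: "Q \<zero>\<^bsub>free_space R S\<^esub>"
    and gen: "\<And>s. s \<in> S \<Longrightarrow> Q (free_gen R s)"
    and add: "\<And>u v. \<lbrakk>u \<in> carrier (free_space R S); v \<in> carrier (free_space R S); Q u; Q v\<rbrakk>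
      \<Longrightarrow> Q (u \<oplus>\<^bsub>free_space R S\<^esub> v)"
    and smult: "\<And>c u. \<lbrakk>c \<in> carrier R; u \<in> carrier (free_space R S); Q u\<rbrakk>
      \<Longrightarrow> Q (c \<odot>\<^bsub>free_space R S\<^esub> u)"
  shows "Q u"
proof -
  \<comment> \<open>The support is replaced by an arbitrary finite set \<open>A\<close> containing
    it, which makes set induction with varying \<open>u\<close> possible.\<close>
  have "Q u" if "finite A" "u \<in> carrier (free_space R S)" "{s. u s \<noteq> \<zero>} \<subseteq> A" for A u
    using that
  proof (induction A arbitrary: u)
    case empty
    then have "u = \<zero>\<^bsub>free_space R S\<^esub>" by (auto simp: free_space_simps)
    then show ?case using zero by simp
  next
    case (insert s A)
    show ?case
    proof (cases "u s = \<zero>")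
      case True
      then show ?thesis using insert by blast
    next
      case False
      then have s: "s \<in> S" using insert.prems by (auto simp: free_space_simps)
      \<comment> \<open>Clearing the coordinate \<open>s\<close> leaves a vector supported in
        \<open>A\<close>; what is removed is a multiple of one generator.\<close>
      define v where "v = u(s := \<zero>)"
      have "{t. v t \<noteq> \<zero>} = {t. u t \<noteq> \<zero>} - {s}" by (auto simp: v_def)
      then have "finite {t. v t \<noteq> \<zero>}"
        using insert.prems(1) by (simp add: free_space_simps)
      then have v: "v \<in> carrier (free_space R S)"
        using insert.prems(1) by (auto simp: free_space_simps v_def)
      have "{t. v t \<noteq> \<zero>} \<subseteq> A" using insert.prems(2) by (auto simp: v_def)
      then have "Q v" by (rule insert.IH[OF v])
      moreover have "u = v \<oplus>\<^bsub>free_space R S\<^esub> (u s \<odot>\<^bsub>free_space R S\<^esub> free_gen R s)"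
        using free_space_coeff[OF insert.prems(1)]
        by (auto simp: v_def free_gen_def free_space_simps fun_eq_iff)
      moreover have "Q (u s \<odot>\<^bsub>free_space R S\<^esub> free_gen R s)"
        using s free_space_coeff[OF insert.prems(1)] by (intro smult gen free_gen_closed)
      ultimately show ?thesis
        using add[OF v free_space_smult_closed[OF free_space_coeff[OF insert.prems(1), of s]
              free_gen_closed[OF s]]]
        by simp
    qed
  qed
  then show ?thesis using u by (auto simp: free_space_simps)
qed

end

section \<open>Universal property of the free module\<close>

lemma formal_sum_map_superset:
  assumes "module K U" "u \<in> carrier (free_space K S)" "h \<in> S \<rightarrow> carrier U"
    and "finite A" "{s. u s \<noteq> \<zero>\<^bsub>K\<^esub>} \<subseteq> A" "A \<subseteq> S"
  shows "formal_sum_map K U h u = (\<Oplus>\<^bsub>U\<^esub> s \<in> A. u s \<odot>\<^bsub>U\<^esub> h s)"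
proof -
  interpret U: module K U by fact
  have h: "h s \<in> carrier U" if "s \<in> A" for s using that assms(3,6) by blast
  have u: "u s \<in> carrier K" for s using assms(2) by (rule U.R.free_space_coeff)
  \<comment> \<open>Enlarging the index set adds only zero terms. This lets vectors with different
    supports be summed over one common finite set.\<close>
  show ?thesis
    unfolding formal_sum_map_def
    using assms(4,5) h u by (intro U.M.add.finprod_mono_neutral_cong_left) auto
qed

lemma formal_sum_map_hom:
  assumes "module K U" "h \<in> S \<rightarrow> carrier U"
  shows "formal_sum_map K U h \<in> module_hom K (free_space K S) U"
proof -
  interpret U: module K U by fact
  note sup = formal_sum_map_superset[OF assms(1) _ assms(2)]
  show ?thesis
  proof (rule module_homI)
    fix u assume u: "u \<in> carrier (free_space K S)"
    then show "formal_sum_map K U h u \<in> carrier U"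
      unfolding formal_sum_map_def
      using assms(2) by (intro U.M.finsum_closed) (auto simp: free_space_simps)
  next
    fix u v assume u: "u \<in> carrier (free_space K S)" and v: "v \<in> carrier (free_space K S)"
    \<comment> \<open>The support of the sum may be smaller than this union because of cancellation,
      so all three formal sums are taken over the union.\<close>
    let ?A = "{s. u s \<noteq> \<zero>\<^bsub>K\<^esub>} \<union> {s. v s \<noteq> \<zero>\<^bsub>K\<^esub>}"
    have A: "finite ?A" "?A \<subseteq> S" using u v by (auto simp: free_space_simps)
    have w: "{s. (u \<oplus>\<^bsub>free_space K S\<^esub> v) s \<noteq> \<zero>\<^bsub>K\<^esub>} \<subseteq> ?A"
      by (auto simp: free_space_simps)
    have h: "h s \<in> carrier U" if "s \<in> ?A" for s using that A(2) assms(2) by blast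
    have c: "u s \<in> carrier K" "v s \<in> carrier K" for s
      using u v by (simp_all add: U.R.free_space_coeff)
    have "(\<Oplus>\<^bsub>U\<^esub> s \<in> ?A. (u \<oplus>\<^bsub>free_space K S\<^esub> v) s \<odot>\<^bsub>U\<^esub> h s)
        = (\<Oplus>\<^bsub>U\<^esub> s \<in> ?A. u s \<odot>\<^bsub>U\<^esub> h s \<oplus>\<^bsub>U\<^esub> v s \<odot>\<^bsub>U\<^esub> h s)"
      using h c by (intro U.M.finsum_cong') (auto simp: free_space_simps(3) U.smult_l_distr)
    also have "\<dots> = (\<Oplus>\<^bsub>U\<^esub> s \<in> ?A. u s \<odot>\<^bsub>U\<^esub> h s) \<oplus>\<^bsub>U\<^esub> (\<Oplus>\<^bsub>U\<^esub> s \<in> ?A. v s \<odot>\<^bsub>U\<^esub> h s)"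
      using h c by (intro U.M.finsum_addf) auto
    finally show "formal_sum_map K U h (u \<oplus>\<^bsub>free_space K S\<^esub> v)
        = formal_sum_map K U h u \<oplus>\<^bsub>U\<^esub> formal_sum_map K U h v"
      using sup[OF U.R.free_space_add_closed[OF u v] A(1) w A(2)]
        sup[OF u A(1) _ A(2)] sup[OF v A(1) _ A(2)]
      by simp
  next
    fix c u assume c: "c \<in> carrier K" and u: "u \<in> carrier (free_space K S)"
    let ?A = "{s. u s \<noteq> \<zero>\<^bsub>K\<^esub>}"
    have A: "finite ?A" "?A \<subseteq> S" using u by (auto simp: free_space_simps)
    have w: "{s. (c \<odot>\<^bsub>free_space K S\<^esub> u) s \<noteq> \<zero>\<^bsub>K\<^esub>} \<subseteq> ?A"
      using c by (auto simp: free_space_simps)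
    have h: "h s \<in> carrier U" if "s \<in> ?A" for s using that A(2) assms(2) by blast
    have k: "u s \<in> carrier K" for s using u by (simp add: U.R.free_space_coeff)
    have "(\<Oplus>\<^bsub>U\<^esub> s \<in> ?A. (c \<odot>\<^bsub>free_space K S\<^esub> u) s \<odot>\<^bsub>U\<^esub> h s)
        = (\<Oplus>\<^bsub>U\<^esub> s \<in> ?A. c \<odot>\<^bsub>U\<^esub> (u s \<odot>\<^bsub>U\<^esub> h s))"
      using h c k by (intro U.M.finsum_cong') (auto simp: free_space_simps(4) U.smult_assoc1)
    also have "\<dots> = c \<odot>\<^bsub>U\<^esub> (\<Oplus>\<^bsub>U\<^esub> s \<in> ?A. u s \<odot>\<^bsub>U\<^esub> h s)"
      using h c k A by (intro U.finsum_smult_ldistr[symmetric]) auto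
    finally show "formal_sum_map K U h (c \<odot>\<^bsub>free_space K S\<^esub> u) = c \<odot>\<^bsub>U\<^esub> formal_sum_map K U h u"
      using sup[OF U.R.free_space_smult_closed[OF c u] A(1) w A(2)] sup[OF u A(1) _ A(2)] by simp
  qed
qed

lemma formal_sum_map_gen:
  assumes "module K U" "h \<in> S \<rightarrow> carrier U" "s \<in> S"
  shows "formal_sum_map K U h (free_gen K s) = h s"
proof -
  interpret U: module K U by fact
  have h: "h s \<in> carrier U" using assms by auto
  \<comment> \<open>The singleton contains the support of the generator even if one equals zero in
    \<open>K\<close>, when that support is empty.\<close>
  have "formal_sum_map K U h (free_gen K s) = (\<Oplus>\<^bsub>U\<^esub> t \<in> {s}. free_gen K s t \<odot>\<^bsub>U\<^esub> h t)"
    using assms by (intro formal_sum_map_superset U.R.free_gen_closed) (auto simp: free_gen_def)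
  then show ?thesis using h by (simp add: free_gen_def)
qed


section \<open>Quotient modules\<close>

lemma submodule_imp_abelian_subgroup:
  assumes "submodule K W V"
  shows "abelian_subgroup W V"
proof -
  interpret W: submodule K W V by fact
  interpret V: module K V by (rule W.module)
  \<comment> \<open>Closure under negation comes from closure under scaling by minus one.\<close>
  have "\<ominus>\<^bsub>V\<^esub> w \<in> W" if "w \<in> W" for w
    using W.smult_closed[of "\<ominus>\<^bsub>K\<^esub> \<one>\<^bsub>K\<^esub>" w] that subsetD[OF W.subset that]
    by (simp add: V.smult_minus_1)
  then have "subgroup W (add_monoid V)"
    using W.subset W.zero_closed
    by (intro V.M.add.subgroupI) (auto simp flip: a_inv_def simp del: W.zero_closed)
  then have "additive_subgroup W V" by (rule additive_subgroupI)
  then show ?thesis by (rule abelian_subgroupI3) (rule V.M.abelian_group_axioms)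
qed

locale quotient_module = submodule K W V for K and W and V (structure)
begin

sublocale V: module K V by (rule module)

sublocale W: abelian_subgroup W V
  by (rule submodule_imp_abelian_subgroup) (rule submodule_axioms)

abbreviation Q where "Q \<equiv> quotient_space V W"

lemma quotient_carrier: "carrier Q = (\<lambda>x. W +> x) ` carrier V"
  by (auto simp: quotient_space_def A_RCOSETS_def')

text \<open>Writing the zero class with a representative lets \<open>quotient_add\<close> apply to
  it. For the same reason the simp rule \<open>a_coset_add_zero\<close>, which would collapse it to
  \<open>W\<close>, is removed in the group proof.\<close>

lemma quotient_zero: "\<zero>\<^bsub>Q\<^esub> = W +> \<zero>"
  by (simp add: quotient_space_def W.a_rcos_const)

lemma quotient_add:
  "x \<in> carrier V \<Longrightarrow> y \<in> carrier V \<Longrightarrow> (W +> x) \<oplus>\<^bsub>Q\<^esub> (W +> y) = W +> (x \<oplus> y)"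
  by (simp add: quotient_space_def W.a_rcos_sum)

text \<open>The union in the definition collapses: two members of one coset differ by an element of
  \<open>W\<close>, and scaling keeps that difference in \<open>W\<close>, so every member
  contributes the same coset.\<close>

lemma quotient_smult:
  assumes c: "c \<in> carrier K" and x: "x \<in> carrier V"
  shows "c \<odot>\<^bsub>Q\<^esub> (W +> x) = W +> (c \<odot> x)"
proof -
  have "W +> (c \<odot> x') = W +> (c \<odot> x)" if x': "x' \<in> W +> x" for x'
  proof -
    obtain w where w: "w \<in> W" "x' = w \<oplus> x" using x' by (auto simp: a_r_coset_def')
    then have "c \<odot> x' = c \<odot> w \<oplus> c \<odot> x" using c x subset by (auto simp: V.smult_r_distr)
    then have "c \<odot> x' \<in> W +> (c \<odot> x)" using w c by (auto simp: a_r_coset_def')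
    then show ?thesis by (rule W.a_repr_independence'[symmetric, OF _ V.smult_closed[OF c x]])
  qed
  moreover have "x \<in> W +> x" using x by (rule W.a_rcos_self)
  ultimately have "(\<Union>x'\<in>W +> x. W +> (c \<odot> x')) = W +> (c \<odot> x)" by blast
  then show ?thesis by (simp add: quotient_space_def)
qed

lemma quotientE:
  assumes "X \<in> carrier Q"
  obtains x where "x \<in> carrier V" "X = W +> x"
  using assms by (auto simp: quotient_carrier)

lemma quotient_closed: "x \<in> carrier V \<Longrightarrow> W +> x \<in> carrier Q"
  by (simp add: quotient_carrier)

lemma quotient_abelian_group: "abelian_group Q"
proof (rule abelian_groupI)
  show "\<zero>\<^bsub>Q\<^esub> \<in> carrier Q" by (simp add: quotient_zero quotient_closed)
next
  fix X Y assume "X \<in> carrier Q" "Y \<in> carrier Q"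
  then show "X \<oplus>\<^bsub>Q\<^esub> Y \<in> carrier Q"
    by (elim quotientE) (simp add: quotient_add quotient_closed)
next
  fix X assume "X \<in> carrier Q"
  then show "\<zero>\<^bsub>Q\<^esub> \<oplus>\<^bsub>Q\<^esub> X = X"
    by (elim quotientE) (simp add: quotient_add quotient_zero del: V.M.a_coset_add_zero)
next
  fix X Y assume "X \<in> carrier Q" "Y \<in> carrier Q"
  then show "X \<oplus>\<^bsub>Q\<^esub> Y = Y \<oplus>\<^bsub>Q\<^esub> X"
    by (elim quotientE) (simp add: quotient_add V.M.a_comm)
next
  fix X Y Z assume "X \<in> carrier Q" "Y \<in> carrier Q" "Z \<in> carrier Q"
  then show "X \<oplus>\<^bsub>Q\<^esub> Y \<oplus>\<^bsub>Q\<^esub> Z = X \<oplus>\<^bsub>Q\<^esub> (Y \<oplus>\<^bsub>Q\<^esub> Z)"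
    by (elim quotientE) (simp add: quotient_add V.M.a_assoc)
next
  fix X assume "X \<in> carrier Q"
  then obtain x where x: "x \<in> carrier V" "X = W +> x" by (rule quotientE)
  then have "(W +> (\<ominus> x)) \<oplus>\<^bsub>Q\<^esub> X = \<zero>\<^bsub>Q\<^esub>"
    by (simp add: quotient_add quotient_zero V.M.l_neg del: V.M.a_coset_add_zero)
  then show "\<exists>Y\<in>carrier Q. Y \<oplus>\<^bsub>Q\<^esub> X = \<zero>\<^bsub>Q\<^esub>"
    using x quotient_closed[of "\<ominus> x"] by blast
qed

lemma quotient_is_module: "module K Q"
  by (rule moduleI)
     (erule quotientE | rule V.R.is_cring quotient_abelian_group
      | simp add: quotient_closed quotient_add quotient_smult V.smult_l_distr V.smult_r_distr
          V.smult_assoc1)+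

lemma coset_map_hom: "(\<lambda>x. W +> x) \<in> module_hom K V Q"
  by (rule module_homI) (simp_all add: quotient_carrier quotient_add quotient_smult)

lemma coset_eqI:
  assumes "x \<in> carrier V" "y \<in> carrier V" "x \<ominus> y \<in> W"
  shows "W +> x = W +> y"
  using W.a_repr_independence'[OF W.a_rcos_module_rev[of y x] assms(2)] assms
  by (simp add: a_minus_def)

lemma coset_diff:
  assumes "x \<in> carrier V" "y \<in> W +> x"
  shows "y \<in> carrier V" "y \<ominus> x \<in> W"
  using W.a_elemrcos_carrier[OF assms] W.a_rcos_module_imp[OF assms]
  by (simp_all add: a_minus_def)

end


section \<open>Tensor products\<close>

definition bilinear_map where
  "bilinear_map K V W U b \<longleftrightarrow>
    (\<forall>v\<in>carrier V. b v \<in> module_hom K W U) \<and> (\<forall>w\<in>carrier W. (\<lambda>v. b v w) \<in> module_hom K V U)"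

lemma bilinear_map_closed:
  "bilinear_map K V W U b \<Longrightarrow> v \<in> carrier V \<Longrightarrow> w \<in> carrier W \<Longrightarrow> b v w \<in> carrier U"
  using module_hom_in[of "b v" K W U w] by (simp add: bilinear_map_def)

lemma bilinear_map_comp:
  assumes "bilinear_map K V W U b" "f \<in> module_hom K V' V" "g \<in> module_hom K W' W"
  shows "bilinear_map K V' W' U (\<lambda>v w. b (f v) (g w))"
  unfolding bilinear_map_def
proof (intro conjI ballI)
  fix v assume "v \<in> carrier V'"
  then have "b (f v) \<in> module_hom K W U"
    using assms(1) module_hom_in[OF assms(2)] by (simp add: bilinear_map_def)
  then show "(\<lambda>w. b (f v) (g w)) \<in> module_hom K W' U" by (rule module_hom_comp[OF assms(3)])
next
  fix w assume "w \<in> carrier W'"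
  then have "(\<lambda>v. b v (g w)) \<in> module_hom K V U"
    using assms(1) module_hom_in[OF assms(3)] by (simp add: bilinear_map_def)
  then show "(\<lambda>v. b (f v) (g w)) \<in> module_hom K V' U" by (rule module_hom_comp[OF assms(2)])
qed

text \<open>Stated for modules because \<open>tensor_module\<close> delivers exactly this structure,
  and in threefold products a factor is itself a tensor product.\<close>

locale tensor_product = V: module K V + W: module K W for K V W
begin

abbreviation F where "F \<equiv> free_space K (carrier V \<times> carrier W)"
abbreviation T where "T \<equiv> tensor K V W"
abbreviation N where "N \<equiv> tensor_relations K V W"
abbreviation gen where "gen v w \<equiv> free_gen K (v, w)"
abbreviation elem where "elem \<equiv> tensor_elem K V W"

sublocale F: module K F by (rule V.R.free_space_module)

lemma gen_closed: "v \<in> carrier V \<Longrightarrow> w \<in> carrier W \<Longrightarrow> gen v w \<in> carrier F"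
  by (simp add: V.R.free_gen_closed)

text \<open>Case analysis over the four families of relations, shared by the proof that they lie in
  the free module and the proof that an induced map kills them.\<close>

lemma bilinear_relations_induct [consumes 1]:
  assumes "r \<in> bilinear_relations K V W"
    and "\<And>v v' w. \<lbrakk>v \<in> carrier V; v' \<in> carrier V; w \<in> carrier W\<rbrakk> \<Longrightarrow>
      Q (gen (v \<oplus>\<^bsub>V\<^esub> v') w \<ominus>\<^bsub>F\<^esub> (gen v w \<oplus>\<^bsub>F\<^esub> gen v' w))"
    and "\<And>v w w'. \<lbrakk>v \<in> carrier V; w \<in> carrier W; w' \<in> carrier W\<rbrakk> \<Longrightarrow>
      Q (gen v (w \<oplus>\<^bsub>W\<^esub> w') \<ominus>\<^bsub>F\<^esub> (gen v w \<oplus>\<^bsub>F\<^esub> gen v w'))"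
    and "\<And>c v w. \<lbrakk>c \<in> carrier K; v \<in> carrier V; w \<in> carrier W\<rbrakk> \<Longrightarrow>
      Q (gen (c \<odot>\<^bsub>V\<^esub> v) w \<ominus>\<^bsub>F\<^esub> c \<odot>\<^bsub>F\<^esub> gen v w)"
    and "\<And>c v w. \<lbrakk>c \<in> carrier K; v \<in> carrier V; w \<in> carrier W\<rbrakk> \<Longrightarrow>
      Q (gen v (c \<odot>\<^bsub>W\<^esub> w) \<ominus>\<^bsub>F\<^esub> c \<odot>\<^bsub>F\<^esub> gen v w)"
  shows "Q r"
  using assms(1) unfolding bilinear_relations_def Let_def Un_iff mem_Collect_eq
  by (elim disjE exE conjE) (simp_all only: assms(2-5))

lemma bilinear_relations_subset: "bilinear_relations K V W \<subseteq> carrier F"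
proof
  fix r assume "r \<in> bilinear_relations K V W"
  then show "r \<in> carrier F"
    by (induction rule: bilinear_relations_induct) (simp_all add: gen_closed F.M.minus_closed)
qed

lemma tensor_relations_submodule: "submodule K N F"
  unfolding tensor_relations_def by (rule F.span_is_submodule[OF bilinear_relations_subset])

sublocale N: quotient_module K N F
  unfolding quotient_module_def by (rule tensor_relations_submodule)

lemma tensor_module: "module K T"
  unfolding tensor_def by (rule N.quotient_is_module)

lemma tensor_carrier: "carrier T = (\<lambda>u. N +>\<^bsub>F\<^esub> u) ` carrier F"
  unfolding tensor_def by (rule N.quotient_carrier)

lemma coset_hom: "(\<lambda>u. N +>\<^bsub>F\<^esub> u) \<in> module_hom K F T"
  unfolding tensor_def by (rule N.coset_map_hom)

lemma tensor_elem_closed: "v \<in> carrier V \<Longrightarrow> w \<in> carrier W \<Longrightarrow> elem v w \<in> carrier T"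
  unfolding tensor_elem_def by (rule module_hom_in[OF coset_hom gen_closed])

lemma relation_imp_eq:
  assumes "x \<ominus>\<^bsub>F\<^esub> y \<in> bilinear_relations K V W" "x \<in> carrier F" "y \<in> carrier F"
  shows "N +>\<^bsub>F\<^esub> x = N +>\<^bsub>F\<^esub> y"
proof (rule N.coset_eqI)
  show "x \<ominus>\<^bsub>F\<^esub> y \<in> N"
    unfolding tensor_relations_def
    by (rule subsetD[OF F.in_own_span[OF bilinear_relations_subset] assms(1)])
qed fact+

lemma bilinear_relationsI:
  shows "\<lbrakk>v \<in> carrier V; v' \<in> carrier V; w \<in> carrier W\<rbrakk> \<Longrightarrow>
      gen (v \<oplus>\<^bsub>V\<^esub> v') w \<ominus>\<^bsub>F\<^esub> (gen v w \<oplus>\<^bsub>F\<^esub> gen v' w) \<in> bilinear_relations K V W"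
    and "\<lbrakk>v \<in> carrier V; w \<in> carrier W; w' \<in> carrier W\<rbrakk> \<Longrightarrow>
      gen v (w \<oplus>\<^bsub>W\<^esub> w') \<ominus>\<^bsub>F\<^esub> (gen v w \<oplus>\<^bsub>F\<^esub> gen v w') \<in> bilinear_relations K V W"
    and "\<lbrakk>c \<in> carrier K; v \<in> carrier V; w \<in> carrier W\<rbrakk> \<Longrightarrow>
      gen (c \<odot>\<^bsub>V\<^esub> v) w \<ominus>\<^bsub>F\<^esub> c \<odot>\<^bsub>F\<^esub> gen v w \<in> bilinear_relations K V W"
    and "\<lbrakk>c \<in> carrier K; v \<in> carrier V; w \<in> carrier W\<rbrakk> \<Longrightarrow>
      gen v (c \<odot>\<^bsub>W\<^esub> w) \<ominus>\<^bsub>F\<^esub> c \<odot>\<^bsub>F\<^esub> gen v w \<in> bilinear_relations K V W"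
  unfolding bilinear_relations_def Let_def
     \<comment> \<open>The union associates to the left, so the first two families sit three
       \<open>Un\<close> rules deep, the third two and the last one. Solving the equation by
       \<open>refl\<close> instantiates the existential variables.\<close>
     apply (rule UnI1, rule UnI1, rule UnI1, rule CollectI, (rule exI)+, rule conjI[OF refl], simp)
    apply (rule UnI1, rule UnI1, rule UnI2, rule CollectI, (rule exI)+, rule conjI[OF refl], simp)
   apply (rule UnI1, rule UnI2, rule CollectI, (rule exI)+, rule conjI[OF refl], simp)
  apply (rule UnI2, rule CollectI, (rule exI)+, rule conjI[OF refl], simp)
  done

lemma tensor_elem_eqI:
  assumes "gen v w \<ominus>\<^bsub>F\<^esub> u \<in> bilinear_relations K V W" "v \<in> carrier V" "w \<in> carrier W"
    and "u \<in> carrier F"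
  shows "elem v w = N +>\<^bsub>F\<^esub> u"
  unfolding tensor_elem_def by (rule relation_imp_eq) (simp_all add: assms gen_closed)

lemma tensor_elem_bilinear: "bilinear_map K V W T elem"
proof -
  \<comment> \<open>With the right-hand sides gathered into a single coset, each bilinearity
    equation says that two formal sums differ by a defining relation, which is what
    \<open>tensor_elem_eqI\<close> asks for.\<close>
  have add: "elem v w \<oplus>\<^bsub>T\<^esub> elem v' w' = N +>\<^bsub>F\<^esub> (gen v w \<oplus>\<^bsub>F\<^esub> gen v' w')"
    if "v \<in> carrier V" "w \<in> carrier W" "v' \<in> carrier V" "w' \<in> carrier W" for v w v' w'
    using that by (simp add: tensor_elem_def module_hom_add[OF coset_hom] gen_closed)
  have smult: "c \<odot>\<^bsub>T\<^esub> elem v w = N +>\<^bsub>F\<^esub> (c \<odot>\<^bsub>F\<^esub> gen v w)"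
    if "c \<in> carrier K" "v \<in> carrier V" "w \<in> carrier W" for c v w
    using that by (simp add: tensor_elem_def module_hom_smult[OF coset_hom] gen_closed)
  show ?thesis
    unfolding bilinear_map_def
    by (intro conjI ballI module_homI tensor_elem_closed)
       (simp_all add: add smult tensor_elem_eqI bilinear_relationsI gen_closed)
qed

text \<open>Uniqueness half of the universal property: every class comes from a formal sum, and both
  composites with the quotient map are linear, so induction over the free module reduces the claim
  to pure tensors.\<close>

lemma tensor_hom_ext:
  assumes U: "module K U" and f: "f \<in> module_hom K T U" and g: "g \<in> module_hom K T U"
    and eq: "\<And>v w. v \<in> carrier V \<Longrightarrow> w \<in> carrier W \<Longrightarrow> f (elem v w) = g (elem v w)"
    and X: "X \<in> carrier T"
  shows "f X = g X"
proof -
  have "f (N +>\<^bsub>F\<^esub> u) = g (N +>\<^bsub>F\<^esub> u)" if "u \<in> carrier F" for u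
    using that
  proof (induction u rule: V.R.free_space_induct)
    case zero
    then show ?case
      using module_hom_zero[OF F.module_axioms U module_hom_comp[OF coset_hom f]]
        module_hom_zero[OF F.module_axioms U module_hom_comp[OF coset_hom g]] by simp
  next
    case (gen s)
    then show ?case using eq by (auto simp: tensor_elem_def)
  next
    case (add u v)
    then show ?case
      using module_hom_add[OF module_hom_comp[OF coset_hom f]]
        module_hom_add[OF module_hom_comp[OF coset_hom g]] by simp
  next
    case (smult c u)
    then show ?case
      using module_hom_smult[OF module_hom_comp[OF coset_hom f]]
        module_hom_smult[OF module_hom_comp[OF coset_hom g]] by simp
  qed
  then show ?thesis using X by (auto simp: tensor_carrier)
qed

section \<open>Existence of the linear map induced by a bilinear map\<close>

context
  fixes U b
  assumes U: "module K U" and b: "bilinear_map K V W U b"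
begin

private abbreviation "\<phi> \<equiv> formal_sum_map K U (\<lambda>(v, w). b v w)"

lemma lift_formal_sum_hom: "\<phi> \<in> module_hom K F U"
  using bilinear_map_closed[OF b] by (intro formal_sum_map_hom[OF U]) auto

lemma lift_formal_sum_gen: "v \<in> carrier V \<Longrightarrow> w \<in> carrier W \<Longrightarrow> \<phi> (gen v w) = b v w"
  using bilinear_map_closed[OF b]
  by (subst formal_sum_map_gen[OF U, where S = "carrier V \<times> carrier W"]) auto

text \<open>The kernel of \<open>\<phi>\<close> is a submodule and contains the generating relations
  by bilinearity of \<open>b\<close>, hence it contains their span.\<close>

lemma lift_formal_sum_relations:
  assumes "u \<in> N"
  shows "\<phi> u = \<zero>\<^bsub>U\<^esub>"
proof -
  interpret U: module K U by (rule U)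
  interpret \<phi>: mod_hom K F U \<phi>
    by unfold_locales (rule lift_formal_sum_hom)
  \<comment> \<open>Every generating relation is a difference, so its membership in the kernel
    reduces to equality of two values of \<open>\<phi>\<close>.\<close>
  have ker: "x \<ominus>\<^bsub>F\<^esub> y \<in> \<phi>.ker"
    if "x \<in> carrier F" "y \<in> carrier F" "\<phi> x = \<phi> y" for x y
  proof -
    have "\<phi> (x \<ominus>\<^bsub>F\<^esub> y) = \<phi> x \<ominus>\<^bsub>U\<^esub> \<phi> y"
      by (rule module_hom_minus[OF F.module_axioms U lift_formal_sum_hom that(1,2)])
    also have "\<dots> = \<zero>\<^bsub>U\<^esub>"
      unfolding that(3) a_minus_def
      by (rule U.M.r_neg[OF module_hom_in[OF lift_formal_sum_hom that(2)]])
    finally show ?thesis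
      unfolding \<phi>.ker_def using F.M.minus_closed[OF that(1,2)] by blast
  qed
  have bl: "b v \<in> module_hom K W U" if "v \<in> carrier V" for v
    using b that by (simp add: bilinear_map_def)
  have br: "(\<lambda>v. b v w) \<in> module_hom K V U" if "w \<in> carrier W" for w
    using b that by (simp add: bilinear_map_def)
  note simps = lift_formal_sum_gen gen_closed module_hom_add[OF lift_formal_sum_hom]
    module_hom_smult[OF lift_formal_sum_hom] module_hom_add[OF bl] module_hom_add[OF br]
    module_hom_smult[OF bl] module_hom_smult[OF br]
  have "r \<in> \<phi>.ker" if "r \<in> bilinear_relations K V W" for r
    using that by (induction rule: bilinear_relations_induct) (simp_all add: ker simps)
  then have "bilinear_relations K V W \<subseteq> \<phi>.ker" by blast
  then have "N \<subseteq> \<phi>.ker"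
    unfolding tensor_relations_def by (rule F.span_is_subset[OF _ \<phi>.ker_is_submodule])
  then show ?thesis using assms by (auto simp: \<phi>.ker_def)
qed

text \<open>Members of a coset differ from \<open>u\<close> by elements that \<open>\<phi>\<close>
  kills, so the image of the coset is a singleton and \<open>the_elem\<close> in
  \<open>tensor_lift\<close> returns the intended value.\<close>

lemma tensor_lift_coset:
  assumes u: "u \<in> carrier F"
  shows "tensor_lift K U b (N +>\<^bsub>F\<^esub> u) = \<phi> u"
proof -
  interpret U: module K U by (rule U)
  note hom = lift_formal_sum_hom
  have "\<phi> x = \<phi> u" if x: "x \<in> N +>\<^bsub>F\<^esub> u" for x
  proof -
    have "\<phi> x \<ominus>\<^bsub>U\<^esub> \<phi> u = \<zero>\<^bsub>U\<^esub>"
      using lift_formal_sum_relations[OF N.coset_diff(2)[OF u x]]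
        module_hom_minus[OF F.module_axioms U hom N.coset_diff(1)[OF u x] u] by simp
    then show ?thesis
      using module_hom_in[OF hom N.coset_diff(1)[OF u x]] module_hom_in[OF hom u] by simp
  qed
  then have "\<phi> ` (N +>\<^bsub>F\<^esub> u) = {\<phi> u}" using N.W.a_rcos_self[OF u] by blast
  then show ?thesis by (simp add: tensor_lift_def)
qed

lemma tensor_lift_hom: "tensor_lift K U b \<in> module_hom K T U"
proof (rule module_homI)
  fix X assume "X \<in> carrier T"
  then show "tensor_lift K U b X \<in> carrier U"
    using module_hom_in[OF lift_formal_sum_hom] by (auto simp: tensor_carrier tensor_lift_coset)
next
  fix X Y assume "X \<in> carrier T" "Y \<in> carrier T"
  then show "tensor_lift K U b (X \<oplus>\<^bsub>T\<^esub> Y) = tensor_lift K U b X \<oplus>\<^bsub>U\<^esub> tensor_lift K U b Y"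
    by (auto simp: tensor_carrier tensor_lift_coset module_hom_add[OF coset_hom, symmetric]
          module_hom_add[OF lift_formal_sum_hom])
next
  fix c X assume "c \<in> carrier K" "X \<in> carrier T"
  then show "tensor_lift K U b (c \<odot>\<^bsub>T\<^esub> X) = c \<odot>\<^bsub>U\<^esub> tensor_lift K U b X"
    by (auto simp: tensor_carrier tensor_lift_coset module_hom_smult[OF coset_hom, symmetric]
          module_hom_smult[OF lift_formal_sum_hom])
qed

lemma tensor_lift_elem:
  "v \<in> carrier V \<Longrightarrow> w \<in> carrier W \<Longrightarrow> tensor_lift K U b (elem v w) = b v w"
  by (simp add: tensor_elem_def tensor_lift_coset gen_closed lift_formal_sum_gen)

end

end

section \<open>Functoriality of the tensor product\<close>

lemmas tensor_module = tensor_product.tensor_module[OF tensor_product.intro]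

lemmas tensor_elem_closed = tensor_product.tensor_elem_closed[OF tensor_product.intro]

lemma
  assumes "module K V" "module K W"
  shows tensor_elem_hom_left:
      "w \<in> carrier W \<Longrightarrow> (\<lambda>v. tensor_elem K V W v w) \<in> module_hom K V (tensor K V W)"
    and tensor_elem_hom_right:
      "v \<in> carrier V \<Longrightarrow> tensor_elem K V W v \<in> module_hom K W (tensor K V W)"
  using tensor_product.tensor_elem_bilinear[OF tensor_product.intro[OF assms]]
  by (simp_all add: bilinear_map_def)

lemma
  assumes V: "module K V" and W: "module K W" and V': "module K V'" and W': "module K W'"
    and f: "f \<in> module_hom K V V'" and g: "g \<in> module_hom K W W'"
  shows tensor_map_hom: "tensor_map K V' W' f g \<in> module_hom K (tensor K V W) (tensor K V' W')"
    and tensor_map_elem: "v \<in> carrier V \<Longrightarrow> w \<in> carrier W \<Longrightarrow>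
      tensor_map K V' W' f g (tensor_elem K V W v w) = tensor_elem K V' W' (f v) (g w)"
proof -
  interpret VW: tensor_product K V W by (rule tensor_product.intro[OF V W])
  interpret VW': tensor_product K V' W' by (rule tensor_product.intro[OF V' W'])
  note b = bilinear_map_comp[OF VW'.tensor_elem_bilinear f g]
  show "tensor_map K V' W' f g \<in> module_hom K (tensor K V W) (tensor K V' W')"
    unfolding tensor_map_def by (rule VW.tensor_lift_hom[OF VW'.tensor_module b])
  show "v \<in> carrier V \<Longrightarrow> w \<in> carrier W \<Longrightarrow>
      tensor_map K V' W' f g (tensor_elem K V W v w) = tensor_elem K V' W' (f v) (g w)"
    unfolding tensor_map_def by (rule VW.tensor_lift_elem[OF VW'.tensor_module b])
qed

text \<open>Both sides are linear and agree on pure tensors. Keeping the composites as separate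
  functions \<open>h\<close> and \<open>k\<close>, described only on the carriers, allows identities
  such as \<open>\<Delta>\<^sub>P (P x) = tm P P (\<Delta> x)\<close> to be used inside one tensor
  factor.\<close>

lemma tensor_map_comp:
  assumes V: "module K V" and W: "module K W" and V': "module K V'" and W': "module K W'"
    and V'': "module K V''" and W'': "module K W''"
    and f: "f \<in> module_hom K V V'" and g: "g \<in> module_hom K W W'"
    and f': "f' \<in> module_hom K V' V''" and g': "g' \<in> module_hom K W' W''"
    and h: "\<And>v. v \<in> carrier V \<Longrightarrow> f' (f v) = h v"
    and k: "\<And>w. w \<in> carrier W \<Longrightarrow> g' (g w) = k w"
    and X: "X \<in> carrier (tensor K V W)"
  shows "tensor_map K V'' W'' f' g' (tensor_map K V' W' f g X) = tensor_map K V'' W'' h k X"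
proof -
  interpret VW: tensor_product K V W by (rule tensor_product.intro[OF V W])
  have hk: "h \<in> module_hom K V V''" "k \<in> module_hom K W W''"
    by (rule module_hom_cong[OF V module_hom_comp[OF f f'] h], assumption,
        rule module_hom_cong[OF W module_hom_comp[OF g g'] k], assumption)
  note homs = tensor_map_hom[OF V W V' W' f g] tensor_map_hom[OF V' W' V'' W'' f' g']
  show ?thesis
    by (rule VW.tensor_hom_ext[OF tensor_module[OF V'' W''] module_hom_comp[OF homs]
          tensor_map_hom[OF V W V'' W'' hk] _ X])
       (simp add: tensor_map_elem[OF V W V' W' f g] tensor_map_elem[OF V' W' V'' W'' f' g']
          tensor_map_elem[OF V W V'' W'' hk] module_hom_in[OF f] module_hom_in[OF g] h k)
qed

section \<open>Threefold tensor products and associativity\<close>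

lemma tensor3_hom_ext:
  assumes U: "module K U" and V: "module K V" and W: "module K W" and M: "module K M"
    and f: "f \<in> module_hom K (tensor K (tensor K U V) W) M"
    and g: "g \<in> module_hom K (tensor K (tensor K U V) W) M"
    and eq: "\<And>u v w. u \<in> carrier U \<Longrightarrow> v \<in> carrier V \<Longrightarrow> w \<in> carrier W \<Longrightarrow>
      f (tensor_elem K (tensor K U V) W (tensor_elem K U V u v) w)
        = g (tensor_elem K (tensor K U V) W (tensor_elem K U V u v) w)"
    and y: "y \<in> carrier (tensor K (tensor K U V) W)"
  shows "f y = g y"
proof -
  interpret UV: tensor_product K U V by (rule tensor_product.intro[OF U V])
  interpret UV_W: tensor_product K UV.T W by (rule tensor_product.intro[OF UV.tensor_module W])
  \<comment> \<open>For fixed \<open>w\<close> both sides are linear in \<open>x\<close>, so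
    extensionality on the inner product applies; extensionality on the outer product then
    finishes.\<close>
  have "f (UV_W.elem x w) = g (UV_W.elem x w)"
    if x: "x \<in> carrier UV.T" and w: "w \<in> carrier W" for x w
  proof -
    note e = tensor_elem_hom_left[OF UV.tensor_module W w]
    show ?thesis
      by (rule UV.tensor_hom_ext[OF M module_hom_comp[OF e f] module_hom_comp[OF e g]
            eq[OF _ _ w] x])
  qed
  then show ?thesis by (rule UV_W.tensor_hom_ext[OF M f g _ y])
qed

text \<open>The associator is a lift of lifts. The outer lift is legitimate once the inner one,
  \<open>?l x w\<close>, is shown to be bilinear in \<open>x\<close> and \<open>w\<close>.\<close>

lemma
  assumes U: "module K U" and V: "module K V" and W: "module K W"
  shows tensor_assoc_hom: "tensor_assoc K U V W \<in>
      module_hom K (tensor K (tensor K U V) W) (tensor K U (tensor K V W))"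
    and tensor_assoc_elem: "u \<in> carrier U \<Longrightarrow> v \<in> carrier V \<Longrightarrow> w \<in> carrier W \<Longrightarrow>
      tensor_assoc K U V W (tensor_elem K (tensor K U V) W (tensor_elem K U V u v) w)
        = tensor_elem K U (tensor K V W) u (tensor_elem K V W v w)"
proof -
  interpret UV: tensor_product K U V by (rule tensor_product.intro[OF U V])
  interpret VW: tensor_product K V W by (rule tensor_product.intro[OF V W])
  interpret UV_W: tensor_product K "tensor K U V" W
    by (rule tensor_product.intro[OF UV.tensor_module W])
  interpret U_VW: tensor_product K U "tensor K V W"
    by (rule tensor_product.intro[OF U VW.tensor_module])
  let ?e = "\<lambda>w u v. U_VW.elem u (VW.elem v w)"
  let ?l = "\<lambda>x w. tensor_lift K U_VW.T (?e w) x"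
  have assoc: "tensor_assoc K U V W = tensor_lift K U_VW.T ?l"
    by (simp add: tensor_assoc_def Let_def)
  note T = U_VW.tensor_module
  note vw_hom = tensor_elem_hom_left[OF V W] tensor_elem_hom_right[OF V W]
  note uvw_hom = tensor_elem_hom_left[OF U VW.tensor_module]
    tensor_elem_hom_right[OF U VW.tensor_module]
  have e: "bilinear_map K U V U_VW.T (?e w)" if "w \<in> carrier W" for w
    using that module_hom_comp[OF vw_hom(1) uvw_hom(2)]
    by (auto simp: bilinear_map_def intro: uvw_hom(1) VW.tensor_elem_closed)
  have l_hom: "(\<lambda>x. ?l x w) \<in> module_hom K UV.T U_VW.T" if "w \<in> carrier W" for w
    using UV.tensor_lift_hom[OF T e[OF that]] .
  have l_elem: "?l (UV.elem u v) w = ?e w u v"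
    if "u \<in> carrier U" "v \<in> carrier V" "w \<in> carrier W" for u v w
    by (rule UV.tensor_lift_elem[OF T e]) fact+
  have ew: "(\<lambda>w. ?e w u v) \<in> module_hom K W U_VW.T" if "u \<in> carrier U" "v \<in> carrier V" for u v
    by (rule module_hom_comp[OF vw_hom(2) uvw_hom(2)]) fact+
  \<comment> \<open>Linearity in \<open>w\<close> does not come with the inner lift. For fixed
    scalars and vectors both sides are linear in \<open>x\<close>, so it is checked on pure tensors,
    where it is linearity of \<open>?e\<close> in \<open>w\<close>.\<close>
  have "?l x \<in> module_hom K W U_VW.T" if x: "x \<in> carrier UV.T" for x
  proof (rule module_homI)
    fix w assume "w \<in> carrier W"
    then show "?l x w \<in> carrier U_VW.T" using l_hom x by (blast intro: module_hom_in)
  next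
    fix w w' assume w: "w \<in> carrier W" "w' \<in> carrier W"
    show "?l x (w \<oplus>\<^bsub>W\<^esub> w') = ?l x w \<oplus>\<^bsub>U_VW.T\<^esub> ?l x w'"
      using w
      by (intro UV.tensor_hom_ext[OF T l_hom module_hom_plus[OF T l_hom l_hom] _ x])
         (simp_all add: l_elem module_hom_add[OF ew])
  next
    fix c w assume w: "c \<in> carrier K" "w \<in> carrier W"
    show "?l x (c \<odot>\<^bsub>W\<^esub> w) = c \<odot>\<^bsub>U_VW.T\<^esub> ?l x w"
      using w
      by (intro UV.tensor_hom_ext[OF T l_hom module_hom_scale[OF T l_hom] _ x])
         (simp_all add: l_elem module_hom_smult[OF ew])
  qed
  with l_hom have l: "bilinear_map K UV.T W U_VW.T ?l" by (simp add: bilinear_map_def)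
  show "tensor_assoc K U V W \<in> module_hom K UV_W.T U_VW.T"
    unfolding assoc by (rule UV_W.tensor_lift_hom[OF T l])
  show "u \<in> carrier U \<Longrightarrow> v \<in> carrier V \<Longrightarrow> w \<in> carrier W \<Longrightarrow>
      tensor_assoc K U V W (UV_W.elem (UV.elem u v) w) = U_VW.elem u (VW.elem v w)"
    unfolding assoc
    by (simp add: UV_W.tensor_lift_elem[OF T l] UV.tensor_elem_closed l_elem)
qed


section \<open>The derived comultiplication\<close>

context noncounitary_rota_baxter_coalgebra
begin

abbreviation T where "T \<equiv> tensor K C C"
abbreviation TC where "TC \<equiv> tensor K T C"
abbreviation CT where "CT \<equiv> tensor K C T"
abbreviation tm where "tm \<equiv> tensor_map K C C"

definition \<Phi> where
  "\<Phi> X = tm P id X \<oplus>\<^bsub>T\<^esub> tm id P X \<oplus>\<^bsub>T\<^esub> lam \<odot>\<^bsub>T\<^esub> X"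

abbreviation \<Delta>\<^sub>P where "\<Delta>\<^sub>P \<equiv> derived_comult K C \<Delta> P lam"

lemma derived_comult_eq: "\<Delta>\<^sub>P x = \<Phi> (\<Delta> x)"
  by (simp add: derived_comult_def \<Phi>_def)

lemmas mod_C = module_axioms
lemmas mod_T = tensor_module[OF mod_C mod_C]
lemmas mod_TC = tensor_module[OF mod_T mod_C]
lemmas mod_CT = tensor_module[OF mod_C mod_T]

sublocale T: module K T by (rule mod_T)
sublocale TC: module K TC by (rule mod_TC)
sublocale CT: module K CT by (rule mod_CT)

lemmas tm_hom = tensor_map_hom[OF mod_C mod_C mod_C mod_C]

lemma Phi_hom: "\<Phi> \<in> module_hom K T T"
  unfolding \<Phi>_def[abs_def]
  by (intro module_hom_plus module_hom_scale mod_T tm_hom operator_linear module_hom_id module_hom_ident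
        weight_closed)

lemma Phi_elem:
  assumes "u \<in> carrier C" "v \<in> carrier C"
  shows "\<Phi> (tensor_elem K C C u v) = tensor_elem K C C (P u) v \<oplus>\<^bsub>T\<^esub> tensor_elem K C C u (P v)
    \<oplus>\<^bsub>T\<^esub> lam \<odot>\<^bsub>T\<^esub> tensor_elem K C C u v"
  unfolding \<Phi>_def
  using assms tensor_map_elem[OF mod_C mod_C mod_C mod_C operator_linear module_hom_id]
    tensor_map_elem[OF mod_C mod_C mod_C mod_C module_hom_id operator_linear]
  by simp

lemma derived_comult_hom: "\<Delta>\<^sub>P \<in> module_hom K C T"
  unfolding derived_comult_eq[abs_def] by (rule module_hom_comp[OF comult_linear Phi_hom])

text \<open>This is the Rota-Baxter equation with its first two summands exchanged; the carrier
  facts justify the exchange.\<close>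

lemma derived_comult_operator:
  assumes "x \<in> carrier C"
  shows "\<Delta>\<^sub>P (P x) = tm P P (\<Delta> x)"
proof -
  have "\<Delta> (P x) \<in> carrier T"
    using assms module_hom_in[OF operator_linear] module_hom_in[OF comult_linear] by blast
  then have "tm P id (\<Delta> (P x)) \<in> carrier T" "tm id P (\<Delta> (P x)) \<in> carrier T"
    using module_hom_in[OF tm_hom[OF operator_linear module_hom_id]]
      module_hom_in[OF tm_hom[OF module_hom_id operator_linear]] by blast+
  then show ?thesis
    unfolding derived_comult_def rota_baxter[OF assms] by (simp add: T.M.a_comm)
qed

text \<open>Applying \<open>tm P P\<close> to the three summands of
  \<open>\<Delta>\<^sub>P x\<close> and commuting it past \<open>tm P id\<close> and
  \<open>tm id P\<close> leaves these operators acting on \<open>tm P P (\<Delta> x)\<close>, which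
  is \<open>\<Delta>\<^sub>P (P x)\<close>.\<close>

lemma derived_rota_baxter:
  assumes "x \<in> carrier C"
  shows "tm P P (\<Delta>\<^sub>P x) =
    tm id P (\<Delta>\<^sub>P (P x)) \<oplus>\<^bsub>T\<^esub> tm P id (\<Delta>\<^sub>P (P x)) \<oplus>\<^bsub>T\<^esub> lam \<odot>\<^bsub>T\<^esub> \<Delta>\<^sub>P (P x)"
proof -
  note P = operator_linear
  note i = module_hom_id[of K C]
  note homs = tm_hom[OF P P] tm_hom[OF P i] tm_hom[OF i P]
  let ?X = "\<Delta> x"
  have X: "?X \<in> carrier T" by (rule module_hom_in[OF comult_linear assms])
  note cl = homs[THEN module_hom_in]
  note comp = tensor_map_comp[OF mod_C mod_C mod_C mod_C mod_C mod_C _ _ _ _ _ _ X]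
  \<comment> \<open>Both orders of composition give the square of \<open>P\<close> in the first
    factor and \<open>P\<close> in the second; the next computation is its mirror image.\<close>
  have "tm P P (tm P id ?X) = tm (\<lambda>v. P (P v)) P ?X"
    by (rule comp) (simp_all add: P i)
  also have "\<dots> = tm P id (tm P P ?X)"
    by (rule comp[symmetric]) (simp_all add: P i)
  finally have 1: "tm P P (tm P id ?X) = tm P id (tm P P ?X)" .
  have "tm P P (tm id P ?X) = tm P (\<lambda>v. P (P v)) ?X"
    by (rule comp) (simp_all add: P i)
  also have "\<dots> = tm id P (tm P P ?X)"
    by (rule comp[symmetric]) (simp_all add: P i)
  finally have 2: "tm P P (tm id P ?X) = tm id P (tm P P ?X)" .
  show ?thesis
    unfolding derived_comult_operator[OF assms] derived_comult_eq[of x] \<Phi>_def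
    using X weight_closed cl
    by (simp add: module_hom_add[OF homs(1)] module_hom_smult[OF homs(1)] 1 2 T.M.a_comm)
qed

text \<open>Both sides are the symmetric operator \<open>E\<close>, grouped in two ways. On a pure
  tensor each expands to the same seven terms: three with two copies of \<open>P\<close>, three with
  one copy and factor \<open>lam\<close>, and one with the square of \<open>lam\<close>.\<close>

lemma derived_assoc:
  assumes y: "y \<in> carrier TC"
  shows "tensor_assoc K C C C
      (tensor_map K T C (tm P P) id y \<oplus>\<^bsub>TC\<^esub> tensor_map K T C \<Phi> P y
        \<oplus>\<^bsub>TC\<^esub> lam \<odot>\<^bsub>TC\<^esub> tensor_map K T C \<Phi> id y) =
    (let z = tensor_assoc K C C C y in
      tensor_map K C T P \<Phi> z \<oplus>\<^bsub>CT\<^esub> tensor_map K C T id (tm P P) z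
        \<oplus>\<^bsub>CT\<^esub> lam \<odot>\<^bsub>CT\<^esub> tensor_map K C T id \<Phi> z)"
proof -
  note P = operator_linear
  note i = module_hom_id[of K C]
  note a = tensor_assoc_hom[OF mod_C mod_C mod_C]
  note l = tensor_map_hom[OF mod_T mod_C mod_T mod_C]
  note r = tensor_map_hom[OF mod_C mod_T mod_C mod_T]
  note elems = tensor_map_elem[OF mod_T mod_C mod_T mod_C tm_hom[OF P P] i]
    tensor_map_elem[OF mod_T mod_C mod_T mod_C Phi_hom P]
    tensor_map_elem[OF mod_T mod_C mod_T mod_C Phi_hom i]
    tensor_map_elem[OF mod_C mod_T mod_C mod_T P Phi_hom]
    tensor_map_elem[OF mod_C mod_T mod_C mod_T i tm_hom[OF P P]]
    tensor_map_elem[OF mod_C mod_T mod_C mod_T i Phi_hom]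
    tensor_map_elem[OF mod_C mod_C mod_C mod_C P P]
    tensor_assoc_elem[OF mod_C mod_C mod_C]
  note closed = tensor_elem_closed[OF mod_C mod_C] tensor_elem_closed[OF mod_T mod_C]
    tensor_elem_closed[OF mod_C mod_T] module_hom_in[OF P] module_hom_in[OF a]
  note lin = module_hom_add[OF a] module_hom_smult[OF a]
    module_hom_add[OF tensor_elem_hom_left[OF mod_T mod_C]]
    module_hom_smult[OF tensor_elem_hom_left[OF mod_T mod_C]]
    module_hom_add[OF tensor_elem_hom_right[OF mod_C mod_T]]
    module_hom_smult[OF tensor_elem_hom_right[OF mod_C mod_T]]
  show ?thesis
    unfolding Let_def
    apply (rule tensor3_hom_ext[OF mod_C mod_C mod_C mod_CT _ _ _ y])
    subgoal
      by (intro module_hom_comp[OF _ a] module_hom_plus module_hom_scale mod_TC l tm_hom P i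
            Phi_hom weight_closed)
    subgoal
      by (intro module_hom_plus module_hom_scale module_hom_comp[OF a] mod_CT r tm_hom P i
            Phi_hom weight_closed)
    subgoal for u v w
      \<comment> \<open>The first call evaluates the tensor maps on pure tensors. The second expands
        \<open>\<Phi>\<close>, distributes, and compares the sums up to order.\<close>
      by (simp only: elems closed)
         (simp add: Phi_elem closed lin elems weight_closed CT.smult_r_distr CT.M.a_ac)
    done
qed

text \<open>Each side is rewritten as operators acting on \<open>?Y\<close> or \<open>?Z\<close>,
  the two iterates of \<open>\<Delta>\<close>. Coassociativity of \<open>\<Delta>\<close> sends
  \<open>?Y\<close> to \<open>?Z\<close> under the associator, and \<open>derived_assoc\<close>
  matches the operators.\<close>

lemma derived_coassoc:
  assumes x: "x \<in> carrier C"
  shows "tensor_assoc K C C C (tensor_map K T C \<Delta>\<^sub>P id (\<Delta>\<^sub>P x)) =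
    tensor_map K C T id \<Delta>\<^sub>P (\<Delta>\<^sub>P x)"
proof -
  note P = operator_linear
  note i = module_hom_id[of K C]
  note d = comult_linear
  note d' = derived_comult_hom
  let ?X = "\<Delta> x"
  let ?Y = "tensor_map K T C \<Delta> id ?X" and ?Z = "tensor_map K C T id \<Delta> ?X"
  have X: "?X \<in> carrier T" by (rule module_hom_in[OF d x])
  note homl = tensor_map_hom[OF mod_C mod_C mod_T mod_C]
  note homr = tensor_map_hom[OF mod_C mod_C mod_C mod_T]
  have Y: "?Y \<in> carrier TC" by (rule module_hom_in[OF homl[OF d i] X])
  note compl = tensor_map_comp[OF mod_C mod_C mod_C mod_C mod_T mod_C _ _ _ _ _ _ X]
  note compl' = tensor_map_comp[OF mod_C mod_C mod_T mod_C mod_T mod_C _ _ _ _ _ _ X]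
  note compr = tensor_map_comp[OF mod_C mod_C mod_C mod_C mod_C mod_T _ _ _ _ _ _ X]
  note compr' = tensor_map_comp[OF mod_C mod_C mod_C mod_T mod_C mod_T _ _ _ _ _ _ X]
  note simps = P i d d' Phi_hom tm_hom derived_comult_eq[symmetric] derived_comult_operator
  \<comment> \<open>The left composite is contracted factorwise by \<open>compl\<close> and split
    again by \<open>compl'\<close>. In the first factor \<open>\<Delta>\<^sub>P\<close> after
    \<open>P\<close> equals \<open>tm P P\<close> after \<open>\<Delta>\<close>, so the copy of
    \<open>\<Delta>\<close> can be moved inside.\<close>
  have l1: "tensor_map K T C \<Delta>\<^sub>P id (tm P id ?X) = tensor_map K T C (tm P P) id ?Y"
    by (rule trans[OF compl compl'[symmetric]]) (simp_all add: simps)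
  \<comment> \<open>Here \<open>P\<close> acts in the other factor, so the first factor uses
    \<open>\<Delta>\<^sub>P = \<Phi> \<Delta>\<close> instead.\<close>
  have l2: "tensor_map K T C \<Delta>\<^sub>P id (tm id P ?X) = tensor_map K T C \<Phi> P ?Y"
    by (rule trans[OF compl compl'[symmetric]]) (simp_all add: simps)
  have l3: "tensor_map K T C \<Delta>\<^sub>P id ?X = tensor_map K T C \<Phi> id ?Y"
    by (rule compl'[symmetric]) (simp_all add: simps)
  \<comment> \<open>On this side \<open>\<Delta>\<^sub>P\<close> acts in the second factor, so the
    roles swap: \<open>tm P id\<close> produces \<open>\<Phi>\<close> and \<open>tm id P\<close>
    produces \<open>tm P P\<close>.\<close>
  have r1: "tensor_map K C T id \<Delta>\<^sub>P (tm P id ?X) = tensor_map K C T P \<Phi> ?Z"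
    by (rule trans[OF compr compr'[symmetric]]) (simp_all add: simps)
  have r2: "tensor_map K C T id \<Delta>\<^sub>P (tm id P ?X) = tensor_map K C T id (tm P P) ?Z"
    by (rule trans[OF compr compr'[symmetric]]) (simp_all add: simps)
  have r3: "tensor_map K C T id \<Delta>\<^sub>P ?X = tensor_map K C T id \<Phi> ?Z"
    by (rule compr'[symmetric]) (simp_all add: simps)
  have cl: "tm P id ?X \<in> carrier T" "tm id P ?X \<in> carrier T"
    using module_hom_in[OF tm_hom[OF P i] X] module_hom_in[OF tm_hom[OF i P] X] .
  have L: "tensor_map K T C \<Delta>\<^sub>P id (\<Delta>\<^sub>P x) =
      tensor_map K T C (tm P P) id ?Y \<oplus>\<^bsub>TC\<^esub> tensor_map K T C \<Phi> P ?Y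
        \<oplus>\<^bsub>TC\<^esub> lam \<odot>\<^bsub>TC\<^esub> tensor_map K T C \<Phi> id ?Y"
    unfolding derived_comult_eq[of x] \<Phi>_def[of "\<Delta> x"]
    using cl X weight_closed
    by (simp add: module_hom_add[OF homl[OF d' i]] module_hom_smult[OF homl[OF d' i]] l1 l2 l3)
  have R: "tensor_map K C T id \<Delta>\<^sub>P (\<Delta>\<^sub>P x) =
      tensor_map K C T P \<Phi> ?Z \<oplus>\<^bsub>CT\<^esub> tensor_map K C T id (tm P P) ?Z
        \<oplus>\<^bsub>CT\<^esub> lam \<odot>\<^bsub>CT\<^esub> tensor_map K C T id \<Phi> ?Z"
    unfolding derived_comult_eq[of x] \<Phi>_def[of "\<Delta> x"]
    using cl X weight_closed
    by (simp add: module_hom_add[OF homr[OF i d']] module_hom_smult[OF homr[OF i d']] r1 r2 r3)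
  show ?thesis
    unfolding L R derived_assoc[OF Y] Let_def coassoc[OF x] ..
qed

lemma derived_rota_baxter_coalgebra: "noncounitary_rota_baxter_coalgebra K C \<Delta>\<^sub>P P lam"
  by unfold_locales
     (rule derived_comult_hom derived_coassoc weight_closed operator_linear derived_rota_baxter;
      assumption?)+

end

theorem proposition3p8:
  fixes K :: "('k, 'm) ring_scheme" and C :: "('k, 'c, 'n) module_scheme"
    and \<Delta> :: "'c \<Rightarrow> ('c \<times> 'c \<Rightarrow> 'k) set" and P :: "'c \<Rightarrow> 'c" and lam :: 'k
  assumes "field K"
    and char_0: "\<And>n :: nat. n \<noteq> 0 \<Longrightarrow> [n] \<cdot>\<^bsub>K\<^esub> \<one>\<^bsub>K\<^esub> \<noteq> \<zero>\<^bsub>K\<^esub>"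
    and "noncounitary_rota_baxter_coalgebra K C \<Delta> P lam"
  shows "(\<forall>x \<in> carrier C. derived_comult K C \<Delta> P lam (P x) = tensor_map K C C P P (\<Delta> x)) \<and>
    noncounitary_rota_baxter_coalgebra K C (derived_comult K C \<Delta> P lam) P lam"
proof -
  interpret noncounitary_rota_baxter_coalgebra K C \<Delta> P lam by fact
  show ?thesis using derived_comult_operator derived_rota_baxter_coalgebra by blast
qed

end
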